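(* Let $\mathbb{P}$ be an $\omega$-poset. Then the maps \[Q\mapsto\mathsf{S}Q\qquad\text{and}\qquad X\mapsto\bigcup X\] are mutually inverse order isomorphisms (with respect to inclusion) between the family of prime subsets $Q\subseteq\mathbb{P}$ and the family of closed subsets $X$ of the spectrum $\mathsf{S}\mathbb{P}$, where $\mathsf{S}Q$ denotes the spectrum (the set of minimal selectors) of $Q$ considered as a poset in its own right with the order induced from $\mathbb{P}$.
   Context: Let $(\mathbb{P},\leq)$ be a poset. A subset $S\subseteq\mathbb{P}$ refines $T\subseteq\mathbb{P}$ if for every $s\in S$ there is $t\in T$ with $s\leq t$. A band of $\mathbb{P}$ is a finite subset $B\subseteq\mathbb{P}$ such that every $p\in\mathbb{P}$ is comparable to some $b\in B$. A cap of $\mathbb{P}$ is a subset refined by some band. A selector is a subset $S\subseteq\mathbb{P}$ with $S\cap C\neq\emptyset$ for every cap $C$ of $\mathbb{P}$; a minimal selector is one minimal with respect to inclusion among all selectors. The spectrum $\mathsf{S}\mathbb{P}$ is the set of all minimal selectors, with the topology generated by the subbasis consisting of the sets $p^\in=\{S\in\mathsf{S}\mathbb{P}:p\in S\}$, for $p\in\mathbb{P}$. $\mathbb{P}$ is an $\omega$-poset if every principal filter $p^\leq=\{q\in\mathbb{P}:p\leq q\}$ is finite and, for each $n\in\omega$, the number of principal filters of size $n$ is finite. The cap-order $\precsim$ on subsets of $\mathbb{P}$ is defined by: $A\precsim B$ if for all $F\subseteq\mathbb{P}$, whenever $F\cup A$ is a cap of $\mathbb{P}$, so is $F\cup B$.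 For $q\in\mathbb{P}$ write $q\precsim B$ for $\{q\}\precsim B$. A subset $Q\subseteq\mathbb{P}$ is prime if $q\not\precsim\mathbb{P}\setminus Q$ for all $q\in Q$ (equivalently: for all $q\in Q$ and $C\subseteq\mathbb{P}$, $q\precsim C$ implies $Q\cap C\neq\emptyset$). *)

theory Defs
  imports "HOL-Analysis.Abstract_Topology"
begin

text \<open>A poset is a carrier set \<open>P :: 'a::order set\<close> with the order restricted to \<open>P\<close>; the
  carrier is explicit so that a subset of a poset is again a poset with the induced order.\<close>

definition refines :: "'a::order set \<Rightarrow> 'a set \<Rightarrow> bool" where
  "refines S T \<longleftrightarrow> (\<forall>s\<in>S. \<exists>t\<in>T. s \<le> t)"

definition band :: "'a::order set \<Rightarrow> 'a set \<Rightarrow> bool" where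
  "band P B \<longleftrightarrow> B \<subseteq> P \<and> finite B \<and> (\<forall>p\<in>P. \<exists>b\<in>B. p \<le> b \<or> b \<le> p)"

definition cap :: "'a::order set \<Rightarrow> 'a set \<Rightarrow> bool" where
  "cap P C \<longleftrightarrow> C \<subseteq> P \<and> (\<exists>B. band P B \<and> refines B C)"

definition selector :: "'a::order set \<Rightarrow> 'a set \<Rightarrow> bool" where
  "selector P S \<longleftrightarrow> S \<subseteq> P \<and> (\<forall>C. cap P C \<longrightarrow> S \<inter> C \<noteq> {})"

definition minimal_selector :: "'a::order set \<Rightarrow> 'a set \<Rightarrow> bool" where
  "minimal_selector P S \<longleftrightarrow> selector P S \<and> (\<forall>T. selector P T \<and> T \<subseteq> S \<longrightarrow> T = S)"

definition spectrum :: "'a::order set \<Rightarrow> 'a set set" where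
  "spectrum P = {S. minimal_selector P S}"

definition spectrum_subbasic :: "'a::order set \<Rightarrow> 'a \<Rightarrow> 'a set set" where
  "spectrum_subbasic P p = {S \<in> spectrum P. p \<in> S}"

text \<open>The qualifier \<open>relative_to spectrum P\<close> makes the empty intersection of subbasic sets
  the whole spectrum.\<close>

definition spectrum_topology :: "'a::order set \<Rightarrow> 'a set topology" where
  "spectrum_topology P =
     topology (arbitrary union_of
       (finite intersection_of (\<lambda>U. U \<in> spectrum_subbasic P ` P) relative_to spectrum P))"

lemma topspace_spectrum_topology: "topspace (spectrum_topology P) = spectrum P"
  unfolding spectrum_topology_def by (rule topspace_subbase)

definition principal_filter :: "'a::order set \<Rightarrow> 'a \<Rightarrow> 'a set" where
  "principal_filter P p = {q \<in> P. p \<le> q}"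

definition omega_poset :: "'a::order set \<Rightarrow> bool" where
  "omega_poset P \<longleftrightarrow>
     (\<forall>p\<in>P. finite (principal_filter P p)) \<and>
     (\<forall>n::nat. finite {F \<in> principal_filter P ` P. card F = n})"

definition cap_le :: "'a::order set \<Rightarrow> 'a set \<Rightarrow> 'a set \<Rightarrow> bool" where
  "cap_le P A B \<longleftrightarrow> (\<forall>F\<subseteq>P. cap P (F \<union> A) \<longrightarrow> cap P (F \<union> B))"

definition prime_subset :: "'a::order set \<Rightarrow> 'a set \<Rightarrow> bool" where
  "prime_subset P Q \<longleftrightarrow> Q \<subseteq> P \<and> (\<forall>q\<in>Q. \<not> cap_le P {q} (P - Q))"

end

theory Submission imports Defs begin

text \<open>
  Caps are closed under supersets in \<open>P\<close>, so a set \<open>S \<subseteq> P\<close> is a selector exactly when \<open>P - S\<close> is not a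
  cap, and a minimal selector is the complement of a maximal non-cap. Bands being finite, every
  cap has a finite subcap, so Zorn's lemma shrinks each selector to a minimal one. Hence
  \<open>q\<close> is below \<open>B\<close> in the cap-order iff every minimal selector through \<open>q\<close> meets \<open>B\<close>
  (\<open>cap_le_iff_spectrum\<close>), and therefore the prime subsets are exactly the unions of minimal
  selectors (\<open>prime_subset_iff_union_of_minimal_selectors\<close>).

  Besides the finiteness of principal filters, the argument rests on one property of
  \<open>\<omega>\<close>-posets: there are bands as fine as one likes, that is, for any finite \<open>F \<subseteq> P\<close> some band has no element strictly above an element of
  \<open>F\<close> (\<open>omega_poset_band_not_strictly_above\<close>). It has two consequences.

  \<^item> Any two caps have a common refinement. Minimal selectors are therefore down-directed
    upsets, so the subbasis of the spectrum is already a basis, and a closed set \<open>X\<close> consists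
    of all minimal selectors contained in \<open>\<Union>X\<close>
    (\<open>closedin_spectrum_eq_minimal_selectors_within_Union\<close>).

  \<^item> For a prime subset \<open>Q\<close>, a set \<open>C \<subseteq> Q\<close> is a cap of \<open>Q\<close> iff \<open>C \<union> (P - Q)\<close> is a cap of \<open>P\<close>
    (\<open>cap_prime_subset_iff\<close>). Passing to complements, the selectors of \<open>Q\<close> are the selectors of
    \<open>P\<close> contained in \<open>Q\<close>, so the spectrum of \<open>Q\<close> consists of the minimal selectors of \<open>P\<close>
    contained in \<open>Q\<close>.

  With both descriptions at hand the two maps are \<open>Q \<mapsto> {S \<in> spectrum P. S \<subseteq> Q}\<close> and \<open>X \<mapsto> \<Union>X\<close>,
  which are monotone and mutually inverse.
\<close>

section \<open>Caps and minimal selectors\<close>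

lemma refines_trans: "refines A B \<Longrightarrow> refines B C \<Longrightarrow> refines A C"
  unfolding refines_def by (meson order_trans)

lemma cap_subset: "cap P C \<Longrightarrow> C \<subseteq> P"
  by (simp add: cap_def)

lemma cap_refines: "cap P A \<Longrightarrow> refines A C \<Longrightarrow> C \<subseteq> P \<Longrightarrow> cap P C"
  unfolding cap_def using refines_trans by blast

lemma cap_mono: "cap P A \<Longrightarrow> A \<subseteq> C \<Longrightarrow> C \<subseteq> P \<Longrightarrow> cap P C"
  by (rule cap_refines) (auto simp: refines_def)

lemma band_imp_cap: "band P B \<Longrightarrow> cap P B"
  unfolding cap_def band_def refines_def by blast

lemma cap_has_finite_subcap:
  assumes "cap P C"
  obtains K where "finite K" "K \<subseteq> C" "cap P K"
proof -
  obtain B where B: "band P B" "refines B C" and C: "C \<subseteq> P"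
    using assms unfolding cap_def by blast
  obtain f where f: "\<And>b. b \<in> B \<Longrightarrow> f b \<in> C \<and> b \<le> f b"
    using B(2) unfolding refines_def by metis
  show thesis
  proof
    show "finite (f ` B)" using B(1) by (simp add: band_def)
    show "f ` B \<subseteq> C" using f by blast
    show "cap P (f ` B)"
      by (rule cap_refines[OF band_imp_cap[OF B(1)]]) (use f C in \<open>auto simp: refines_def\<close>)
  qed
qed

lemma selector_iff_compl_not_cap: "selector P S \<longleftrightarrow> S \<subseteq> P \<and> \<not> cap P (P - S)"
proof (cases "S \<subseteq> P")
  case True
  have "cap P (P - S)" if "cap P C" "S \<inter> C = {}" for C
    by (rule cap_mono[OF that(1)]) (use that(2) cap_subset[OF that(1)] in auto)
  then show ?thesis using True unfolding selector_def by blast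
qed (simp add: selector_def)

text \<open>A maximal non-cap containing \<open>P - T\<close> exists because a cap contained in the union of a chain has
  a finite subcap, which lies in a single member of the chain. Its complement is the minimal
  selector sought.\<close>

lemma selector_contains_minimal_selector:
  assumes "selector P T"
  obtains S where "S \<in> spectrum P" "S \<subseteq> T"
proof -
  let ?N = "{N. P - T \<subseteq> N \<and> N \<subseteq> P \<and> \<not> cap P N}"
  have "\<exists>M\<in>?N. \<forall>X\<in>?N. M \<subseteq> X \<longrightarrow> X = M"
  proof (rule subset_Zorn_nonempty)
    show "?N \<noteq> {}" using assms by (auto simp: selector_iff_compl_not_cap)
  next
    fix \<C> assume \<C>: "\<C> \<noteq> {}" "subset.chain ?N \<C>"
    then have sub: "\<C> \<subseteq> ?N" by (simp add: subset_chain_def)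
    have "\<not> cap P (\<Union>\<C>)"
    proof
      assume "cap P (\<Union>\<C>)"
      then obtain K where K: "finite K" "K \<subseteq> \<Union>\<C>" "cap P K"
        by (rule cap_has_finite_subcap)
      obtain N where "N \<in> \<C>" "K \<subseteq> N"
        using finite_subset_Union_chain[OF K(1,2) \<C>] by blast
      then have "N \<subseteq> P" "\<not> cap P N" using sub by auto
      with cap_mono[OF K(3) \<open>K \<subseteq> N\<close>] show False by simp
    qed
    moreover have "\<Union>\<C> \<subseteq> P" using sub by blast
    moreover have "P - T \<subseteq> \<Union>\<C>" using sub \<C>(1) by fast
    ultimately show "\<Union>\<C> \<in> ?N" by simp
  qed
  then obtain M where M: "P - T \<subseteq> M" "M \<subseteq> P" "\<not> cap P M"
    and max: "\<And>X. P - T \<subseteq> X \<Longrightarrow> X \<subseteq> P \<Longrightarrow> \<not> cap P X \<Longrightarrow> M \<subseteq> X \<Longrightarrow> X = M"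
    by (metis (mono_tags, lifting) mem_Collect_eq)
  have "P - (P - M) = M" using M(2) by blast
  then have "selector P (P - M)"
    using M by (simp add: selector_iff_compl_not_cap)
  moreover have "R = P - M" if R: "selector P R" "R \<subseteq> P - M" for R
  proof -
    have R': "R \<subseteq> P" "\<not> cap P (P - R)"
      using R(1) by (simp_all add: selector_iff_compl_not_cap)
    have MR: "M \<subseteq> P - R" using R(2) M(2) by blast
    have "P - R = M"
      by (rule max[OF subset_trans[OF M(1) MR] Diff_subset R'(2) MR])
    then show ?thesis using R'(1) by blast
  qed
  ultimately have "P - M \<in> spectrum P"
    by (simp add: spectrum_def minimal_selector_def)
  moreover have "P - M \<subseteq> T" using M(1) by blast
  ultimately show thesis by (rule that)
qed

lemma spectrum_selector: "S \<in> spectrum P \<Longrightarrow> selector P S"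
  by (simp add: spectrum_def minimal_selector_def)

lemma spectrum_subset: "S \<in> spectrum P \<Longrightarrow> S \<subseteq> P"
  using spectrum_selector by (auto simp: selector_def)

lemma spectrum_meets_cap: "S \<in> spectrum P \<Longrightarrow> cap P C \<Longrightarrow> S \<inter> C \<noteq> {}"
  using spectrum_selector by (auto simp: selector_def)

text \<open>A cap \<open>C\<close> with \<open>S \<inter> C = {s}\<close> witnesses that \<open>s\<close> cannot be removed from \<open>S\<close>; all further properties
  of minimal selectors are read off from such caps.\<close>

lemma minimal_selector_cap_meets_only:
  assumes "S \<in> spectrum P" "s \<in> S"
  obtains C where "cap P C" "S \<inter> C = {s}"
proof -
  have "\<not> selector P (S - {s})"
    using assms unfolding spectrum_def minimal_selector_def by blast
  then obtain C where C: "cap P C" "(S - {s}) \<inter> C = {}"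
    using spectrum_subset[OF assms(1)] unfolding selector_def by blast
  moreover have "S \<inter> C \<noteq> {}"
    using assms(1) C(1) by (rule spectrum_meets_cap)
  ultimately have "S \<inter> C = {s}" by blast
  with C(1) show thesis by (rule that)
qed

text \<open>Replacing \<open>s\<close> by a larger \<open>t\<close> in a cap that meets \<open>S\<close> only in \<open>s\<close> yields a cap again, and \<open>t\<close>
  is the only element in which \<open>S\<close> can meet it.\<close>

lemma minimal_selector_up_closed:
  assumes "S \<in> spectrum P" "s \<in> S" "s \<le> t" "t \<in> P"
  shows "t \<in> S"
proof -
  obtain C where C: "cap P C" "S \<inter> C = {s}"
    using assms(1,2) by (rule minimal_selector_cap_meets_only)
  have "cap P (insert t (C - {s}))"
    by (rule cap_refines[OF C(1)])
      (use assms(3,4) cap_subset[OF C(1)] in \<open>auto simp: refines_def\<close>)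
  then have "S \<inter> insert t (C - {s}) \<noteq> {}"
    by (rule spectrum_meets_cap[OF assms(1)])
  with C(2) show ?thesis by blast
qed

section \<open>The cap-order and prime subsets\<close>

text \<open>If \<open>S\<close> contains \<open>q\<close> and misses \<open>B\<close>, then \<open>F = P - S\<close> refutes the cap-order, since
  minimality of \<open>S\<close> makes \<open>F \<union> {q}\<close> a cap while \<open>F \<union> B = F\<close> is none. Conversely, if \<open>F \<union> {q}\<close> is a cap
  but \<open>F \<union> B\<close> is not, a minimal selector that avoids \<open>F \<union> B\<close> is forced to contain \<open>q\<close>.\<close>

lemma cap_le_iff_spectrum:
  assumes "B \<subseteq> P" "q \<in> P"
  shows "cap_le P {q} B \<longleftrightarrow> (\<forall>S\<in>spectrum P. q \<in> S \<longrightarrow> S \<inter> B \<noteq> {})"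
proof (intro iffI ballI impI notI)
  fix S assume le: "cap_le P {q} B" and S: "S \<in> spectrum P" "q \<in> S" and disj: "S \<inter> B = {}"
  obtain C where C: "cap P C" "S \<inter> C = {q}"
    using S by (rule minimal_selector_cap_meets_only)
  have "cap P ((P - S) \<union> {q})"
    by (rule cap_mono[OF C(1)]) (use C assms cap_subset[OF C(1)] in auto)
  with le have "cap P ((P - S) \<union> B)" by (simp add: cap_le_def)
  moreover have "(P - S) \<union> B = P - S" using disj assms(1) by blast
  ultimately show False
    using spectrum_selector[OF S(1)] by (simp add: selector_iff_compl_not_cap)
next
  assume meets: "\<forall>S\<in>spectrum P. q \<in> S \<longrightarrow> S \<inter> B \<noteq> {}"
  show "cap_le P {q} B"
    unfolding cap_le_def
  proof (intro allI impI, rule ccontr)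
    fix F assume F: "F \<subseteq> P" "cap P (F \<union> {q})" "\<not> cap P (F \<union> B)"
    have "P - (P - (F \<union> B)) = F \<union> B" using F(1) assms(1) by blast
    then have "selector P (P - (F \<union> B))"
      using F(3) by (simp add: selector_iff_compl_not_cap)
    then obtain S where S: "S \<in> spectrum P" "S \<subseteq> P - (F \<union> B)"
      by (rule selector_contains_minimal_selector)
    have "S \<inter> (F \<union> {q}) \<noteq> {}"
      using S(1) F(2) by (rule spectrum_meets_cap)
    then have "q \<in> S" using S(2) by blast
    with meets S(1) have "S \<inter> B \<noteq> {}" by simp
    with S(2) show False by blast
  qed
qed

lemma prime_subset_iff_union_of_minimal_selectors:
  "prime_subset P Q \<longleftrightarrow> Q \<subseteq> P \<and> (\<forall>q\<in>Q. \<exists>S\<in>spectrum P. q \<in> S \<and> S \<subseteq> Q)"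
proof -
  have meet: "S \<inter> (P - Q) = {} \<longleftrightarrow> S \<subseteq> Q" if "S \<in> spectrum P" for S
    using spectrum_subset[OF that] by blast
  have pointwise: "\<not> cap_le P {q} (P - Q) \<longleftrightarrow> (\<exists>S\<in>spectrum P. q \<in> S \<and> S \<subseteq> Q)" if "q \<in> P" for q
    unfolding cap_le_iff_spectrum[OF Diff_subset that] using meet by metis
  have "(\<forall>q\<in>Q. \<not> cap_le P {q} (P - Q)) \<longleftrightarrow> (\<forall>q\<in>Q. \<exists>S\<in>spectrum P. q \<in> S \<and> S \<subseteq> Q)"
    if "Q \<subseteq> P" using that by (intro ball_cong refl pointwise) (rule subsetD)
  then show ?thesis unfolding prime_subset_def by (rule conj_cong[OF refl])
qed

section \<open>Fine bands in \<open>\<omega>\<close>-posets\<close>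

text \<open>The cone of height \<open>n\<close> collects the elements of rank less than \<open>n\<close>, where the rank is the length
  of the longest strictly increasing chain starting at the element, counted in steps. The recursion
  says so without mentioning chains.\<close>

primrec cone :: "'a::order set \<Rightarrow> nat \<Rightarrow> 'a set" where
  "cone P 0 = {}"
| "cone P (Suc n) = {p \<in> P. \<forall>q\<in>P. p < q \<longrightarrow> q \<in> cone P n}"

lemma cone_subset: "cone P n \<subseteq> P"
  by (cases n) auto

lemma cone_Suc_mono: "cone P n \<subseteq> cone P (Suc n)"
proof (induction n)
  case (Suc n)
  show ?case
  proof
    fix p assume "p \<in> cone P (Suc n)"
    then have p: "p \<in> P" "\<And>q. q \<in> P \<Longrightarrow> p < q \<Longrightarrow> q \<in> cone P n" by simp_all
    have "\<forall>q\<in>P. p < q \<longrightarrow> q \<in> cone P (Suc n)"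
      by (intro ballI impI subsetD[OF Suc] p(2))
    then show "p \<in> cone P (Suc (Suc n))"
      unfolding cone.simps(2)[of P "Suc n"] using p(1) by (intro CollectI conjI)
  qed
qed simp

lemma cone_mono: "m \<le> n \<Longrightarrow> cone P m \<subseteq> cone P n"
  by (rule lift_Suc_mono_le[of "cone P"]) (rule cone_Suc_mono)

lemma omega_poset_finite_filter: "omega_poset P \<Longrightarrow> p \<in> P \<Longrightarrow> finite (principal_filter P p)"
  by (simp add: omega_poset_def)

text \<open>The principal filter of an element of \<open>cone P (Suc n)\<close> consists of that element and members of
  \<open>cone P n\<close>, which bounds its size. An element is determined by its principal filter, so only
  finitely many elements have a filter of bounded size.\<close>

lemma finite_cone:
  assumes "omega_poset P"
  shows "finite (cone P n)"
proof (induction n)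
  case (Suc n)
  have inj: "inj_on (principal_filter P) P"
    by (rule inj_onI) (auto simp: principal_filter_def set_eq_iff intro: order.antisym)
  have fin: "finite {p \<in> P. card (principal_filter P p) = k}" for k
  proof (rule inj_on_finite)
    show "inj_on (principal_filter P) {p \<in> P. card (principal_filter P p) = k}"
      by (rule inj_on_subset[OF inj]) auto
    show "principal_filter P ` {p \<in> P. card (principal_filter P p) = k}
        \<subseteq> {F \<in> principal_filter P ` P. card F = k}" by auto
    show "finite {F \<in> principal_filter P ` P. card F = k}"
      using assms by (simp add: omega_poset_def)
  qed
  have "card (principal_filter P p) \<le> Suc (card (cone P n))" if "p \<in> cone P (Suc n)" for p
  proof -
    have "principal_filter P p \<subseteq> insert p (cone P n)"
      using that by (auto simp: principal_filter_def order.order_iff_strict)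
    then have "card (principal_filter P p) \<le> card (insert p (cone P n))"
      using Suc by (intro card_mono) auto
    also have "\<dots> \<le> Suc (card (cone P n))" by (rule card_insert_le_m1) auto
    finally show ?thesis .
  qed
  then have "cone P (Suc n)
      \<subseteq> (\<Union>k\<le>Suc (card (cone P n)). {p \<in> P. card (principal_filter P p) = k})"
    using cone_subset[of P "Suc n"] by auto
  then show ?case
    by (rule finite_subset) (intro finite_UN_I finite_atMost fin)
qed simp

lemma cones_exhaust:
  assumes "omega_poset P" "p \<in> P"
  shows "p \<in> cone P (card (principal_filter P p))"
  using assms(2)
proof (induction "card (principal_filter P p)" arbitrary: p rule: less_induct)
  case less
  have fin: "finite (principal_filter P p)"
    using assms(1) less.prems by (rule omega_poset_finite_filter)
  have p: "p \<in> principal_filter P p" using less.prems by (simp add: principal_filter_def)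
  then obtain n where n: "card (principal_filter P p) = Suc n"
    using fin by (metis card_gt_0_iff empty_iff gr0_implies_Suc)
  have "q \<in> cone P n" if "q \<in> P" "p < q" for q
  proof -
    have "principal_filter P q \<subset> principal_filter P p"
      using that less.prems by (force simp: principal_filter_def)
    then have lt: "card (principal_filter P q) < card (principal_filter P p)"
      using fin by (rule psubset_card_mono[rotated])
    then have "q \<in> cone P (card (principal_filter P q))"
      using that(1) by (rule less.hyps)
    moreover have "card (principal_filter P q) \<le> n" using lt n by simp
    ultimately show ?thesis using cone_mono by blast
  qed
  then show ?case using less.prems by (simp add: n)
qed

text \<open>The minimal elements of a cone that contains \<open>F\<close> serve as \<open>L\<close>. An element inside the cone lies
  above one of them because the cone is finite. An element outside lies below some element of
  the largest rank that occurs in the cone, and such an element is minimal in the cone.\<close>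

lemma omega_poset_band_not_strictly_above:
  assumes P: "omega_poset P" and F: "finite F" "F \<subseteq> P"
  obtains L where "band P L" "\<And>l b. l \<in> L \<Longrightarrow> b \<in> F \<Longrightarrow> \<not> b < l"
proof -
  obtain n where n: "F \<subseteq> cone P (Suc n)"
  proof
    let ?n = "Max ((\<lambda>b. card (principal_filter P b)) ` F)"
    show "F \<subseteq> cone P (Suc ?n)"
    proof
      fix b assume b: "b \<in> F"
      then have "card (principal_filter P b) \<le> Suc ?n"
        using F(1) by (intro le_SucI Max_ge) auto
      moreover have "b \<in> cone P (card (principal_filter P b))"
        using b F(2) by (intro cones_exhaust[OF P]) auto
      ultimately show "b \<in> cone P (Suc ?n)" using cone_mono by blast
    qed
  qed
  let ?C = "cone P (Suc n)"
  define L where "L = {l \<in> ?C. \<forall>b\<in>?C. \<not> b < l}"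
  show thesis
  proof
    show "\<not> b < l" if "l \<in> L" "b \<in> F" for l b
      using that n by (auto simp: L_def)
    have "\<exists>l\<in>L. p \<le> l \<or> l \<le> p" if p: "p \<in> P" for p
    proof (cases "p \<in> ?C")
      case True
      obtain l where "l \<in> ?C" "l \<le> p" "\<forall>b\<in>?C. b \<le> l \<longrightarrow> b = l"
        using finite_has_minimal2[OF finite_cone[OF P] True] by metis
      then have "l \<in> L" unfolding L_def by force
      with \<open>l \<le> p\<close> show ?thesis by blast
    next
      case False
      \<comment> \<open>Everything above a maximal element of \<open>?A\<close> lies in \<open>cone P n\<close>, so such an element has rank
        exactly \<open>n\<close>.\<close>
      let ?A = "principal_filter P p - cone P n"
      have "p \<in> ?A" using False p cone_Suc_mono by (auto simp: principal_filter_def)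
      moreover have "finite ?A" using omega_poset_finite_filter[OF P p] by simp
      ultimately obtain l where l: "l \<in> ?A" "\<forall>b\<in>?A. l \<le> b \<longrightarrow> b = l"
        using finite_has_maximal[of ?A] by (metis empty_iff)
      have lP: "l \<in> P" "p \<le> l" using l(1) by (auto simp: principal_filter_def)
      have "b \<in> cone P n" if b: "b \<in> P" "l < b" for b
      proof (rule ccontr)
        assume "b \<notin> cone P n"
        then have "b \<in> ?A"
          using b lP(2) by (simp add: principal_filter_def)
        with l(2) b(2) show False by (auto simp: less_le)
      qed
      with lP(1) have "l \<in> ?C" by simp
      moreover have "\<not> b < l" if "b \<in> ?C" for b
        using that l(1) by (auto simp: principal_filter_def)
      ultimately have "l \<in> L" by (simp add: L_def)
      with l(1) show ?thesis by (auto simp: principal_filter_def)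
    qed
    moreover have LC: "L \<subseteq> ?C" unfolding L_def by (rule Collect_restrict)
    moreover have "finite L" using LC finite_cone[OF P] by (rule finite_subset)
    moreover have "L \<subseteq> P" using LC cone_subset by (rule subset_trans)
    ultimately show "band P L" by (simp add: band_def)
  qed
qed

text \<open>A band \<open>L\<close> none of whose elements is strictly above an element of the band \<open>A\<close> refines \<open>A\<close>,
  because comparability leaves only one direction.\<close>

lemma caps_common_refinement:
  assumes P: "omega_poset P" and C: "cap P C" and D: "cap P D"
  obtains L where "band P L" "refines L C" "refines L D"
proof -
  obtain A B where A: "band P A" "refines A C" and B: "band P B" "refines B D"
    using C D unfolding cap_def by blast
  obtain L where L: "band P L" "\<And>l b. l \<in> L \<Longrightarrow> b \<in> A \<union> B \<Longrightarrow> \<not> b < l"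
  proof (rule omega_poset_band_not_strictly_above[OF P])
    show "finite (A \<union> B)" "A \<union> B \<subseteq> P" using A(1) B(1) by (auto simp: band_def)
  qed blast
  have "refines L E" if E: "band P E" "E \<subseteq> A \<union> B" for E
    unfolding refines_def
  proof
    fix l assume l: "l \<in> L"
    then have "l \<in> P" using L(1) by (auto simp: band_def)
    then obtain b where b: "b \<in> E" "l \<le> b \<or> b \<le> l" using E(1) unfolding band_def by blast
    moreover have "\<not> b < l" using L(2)[OF l] b(1) E(2) by blast
    ultimately show "\<exists>t\<in>E. l \<le> t" by (auto simp: order.order_iff_strict)
  qed
  then have "refines L A" "refines L B" using A(1) B(1) by simp_all
  then show thesis
    using that[OF L(1)] refines_trans[OF _ A(2)] refines_trans[OF _ B(2)] by simp
qed

section \<open>The topology of the spectrum\<close>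

text \<open>Let \<open>C\<close> and \<open>D\<close> be caps meeting \<open>S\<close> only in \<open>r\<close> and only in \<open>g\<close>. An element of \<open>S\<close> in a common
  refinement is below members of \<open>C\<close> and \<open>D\<close>; these belong to the upset \<open>S\<close>, so they are \<open>r\<close> and \<open>g\<close>.\<close>

lemma minimal_selector_down_directed:
  assumes P: "omega_poset P" and S: "S \<in> spectrum P" and G: "finite G" "G \<subseteq> S"
  shows "\<exists>r\<in>S. \<forall>g\<in>G. r \<le> g"
  using G
proof (induction G rule: finite_induct)
  case empty
  obtain L where "band P L"
    using P finite.emptyI empty_subsetI by (rule omega_poset_band_not_strictly_above)
  then have "S \<inter> L \<noteq> {}"
    by (intro spectrum_meets_cap[OF S] band_imp_cap)
  then show ?case by blast
next
  case (insert g G)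
  then have g: "g \<in> S" and "\<exists>r\<in>S. \<forall>h\<in>G. r \<le> h" by simp_all
  then obtain r where r: "r \<in> S" "\<forall>h\<in>G. r \<le> h" by blast
  obtain C where C: "cap P C" "S \<inter> C = {r}"
    using S r(1) by (rule minimal_selector_cap_meets_only)
  obtain D where D: "cap P D" "S \<inter> D = {g}"
    using S g by (rule minimal_selector_cap_meets_only)
  obtain L where L: "band P L" "refines L C" "refines L D"
    using P C(1) D(1) by (rule caps_common_refinement)
  obtain l where l: "l \<in> S" "l \<in> L"
    using spectrum_meets_cap[OF S band_imp_cap[OF L(1)]] by blast
  obtain c d where cd: "c \<in> C" "l \<le> c" "d \<in> D" "l \<le> d"
    using L(2,3) l(2) unfolding refines_def by blast
  then have "c \<in> S" "d \<in> S"
    using minimal_selector_up_closed[OF S l(1)] cap_subset[OF C(1)] cap_subset[OF D(1)] by blast+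
  then have "c = r" "d = g" using cd C(2) D(2) by blast+
  then have "l \<le> r" "l \<le> g" using cd by simp_all
  then have "\<forall>h\<in>insert g G. l \<le> h" using r(2) order_trans[OF \<open>l \<le> r\<close>] by simp
  with l(1) show ?case by blast
qed

lemma openin_spectrum_topology_subbasic:
  assumes "p \<in> P"
  shows "openin (spectrum_topology P) (spectrum_subbasic P p)"
proof -
  have "spectrum_subbasic P p = spectrum P \<inter> spectrum_subbasic P p"
    by (auto simp: spectrum_subbasic_def)
  moreover have "(finite intersection_of (\<lambda>U. U \<in> spectrum_subbasic P ` P)) (spectrum_subbasic P p)"
    using assms by (intro finite_intersection_of_inc) simp
  ultimately have "(finite intersection_of (\<lambda>U. U \<in> spectrum_subbasic P ` P) relative_to spectrum P)
      (spectrum_subbasic P p)"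
    unfolding relative_to_def by metis
  then show ?thesis
    unfolding spectrum_topology_def openin_subbase by (rule arbitrary_union_of_inc)
qed

text \<open>A lower bound \<open>r \<in> S\<close> of finitely many \<open>g \<in> S\<close> turns a finite intersection of subbasic
  neighbourhoods of \<open>S\<close> into a single one, since minimal selectors are upsets.\<close>

lemma openin_spectrum_topology_basic_nbhd:
  assumes P: "omega_poset P" and U: "openin (spectrum_topology P) U" and S: "S \<in> U"
  obtains r where "r \<in> S" "spectrum_subbasic P r \<subseteq> U"
proof -
  let ?basic = "finite intersection_of (\<lambda>U. U \<in> spectrum_subbasic P ` P) relative_to spectrum P"
  have "(arbitrary union_of ?basic) U"
    using U unfolding spectrum_topology_def openin_subbase .
  then obtain \<U> where \<U>: "\<U> \<subseteq> Collect ?basic" "\<Union>\<U> = U"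
    unfolding union_of_def by blast
  obtain V where "V \<in> \<U>" and V: "S \<in> V" "V \<subseteq> U" using S \<U>(2) by blast
  then have "?basic V" using \<U>(1) by blast
  then obtain W where W: "(finite intersection_of (\<lambda>U. U \<in> spectrum_subbasic P ` P)) W"
      "spectrum P \<inter> W = V"
    unfolding relative_to_def by blast
  obtain \<F> where F: "finite \<F>" "\<F> \<subseteq> spectrum_subbasic P ` P" "W = \<Inter>\<F>"
    using W(1) unfolding intersection_of_def by blast
  obtain G where G: "G \<subseteq> P" "finite G" "\<F> = spectrum_subbasic P ` G"
    using finite_subset_image[OF F(1,2)] by blast
  have V_eq: "V = spectrum P \<inter> (\<Inter>g\<in>G. spectrum_subbasic P g)"
    using W(2) F(3) G(3) by simp
  have SP: "S \<in> spectrum P" using V(1) V_eq by blast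
  have "S \<in> spectrum_subbasic P g" if "g \<in> G" for g using V(1) V_eq that by blast
  then have GS: "G \<subseteq> S" by (auto simp: spectrum_subbasic_def)
  obtain r where r: "r \<in> S" "\<forall>g\<in>G. r \<le> g"
    using minimal_selector_down_directed[OF P SP G(2) GS] by blast
  have "spectrum_subbasic P r \<subseteq> spectrum_subbasic P g" if "g \<in> G" for g
  proof
    fix T assume "T \<in> spectrum_subbasic P r"
    then have T: "T \<in> spectrum P" "r \<in> T" by (simp_all add: spectrum_subbasic_def)
    have "g \<in> T"
      using r(2) G(1) that by (intro minimal_selector_up_closed[OF T]) blast+
    with T(1) show "T \<in> spectrum_subbasic P g" by (simp add: spectrum_subbasic_def)
  qed
  moreover have "spectrum_subbasic P r \<subseteq> spectrum P"
    unfolding spectrum_subbasic_def by (rule Collect_restrict)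
  ultimately have "spectrum_subbasic P r \<subseteq> V"
    unfolding V_eq by (intro Int_greatest INT_greatest)
  with V(2) have "spectrum_subbasic P r \<subseteq> U" by blast
  with r(1) show thesis by (rule that)
qed

lemma closedin_minimal_selectors_within:
  "closedin (spectrum_topology P) {S \<in> spectrum P. S \<subseteq> Q}"
proof -
  have "spectrum P - {S \<in> spectrum P. S \<subseteq> Q} = (\<Union>p\<in>P - Q. spectrum_subbasic P p)"
    unfolding spectrum_subbasic_def using spectrum_subset[of _ P] by auto
  moreover have "openin (spectrum_topology P) (\<Union>p\<in>P - Q. spectrum_subbasic P p)"
    by (auto intro: openin_spectrum_topology_subbasic)
  ultimately show ?thesis
    by (auto simp: closedin_def topspace_spectrum_topology)
qed

lemma closedin_spectrum_eq_minimal_selectors_within_Union: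
  assumes P: "omega_poset P" and X: "closedin (spectrum_topology P) X"
  shows "{S \<in> spectrum P. S \<subseteq> \<Union>X} = X"
proof
  have XP: "X \<subseteq> spectrum P" and op: "openin (spectrum_topology P) (spectrum P - X)"
    using X by (auto simp: closedin_def topspace_spectrum_topology)
  then show "X \<subseteq> {S \<in> spectrum P. S \<subseteq> \<Union>X}" by blast
  show "{S \<in> spectrum P. S \<subseteq> \<Union>X} \<subseteq> X"
  proof (rule ccontr)
    assume "\<not> ?thesis"
    then obtain S where S: "S \<in> spectrum P" "S \<subseteq> \<Union>X" "S \<in> spectrum P - X" by blast
    obtain r where r: "r \<in> S" "spectrum_subbasic P r \<subseteq> spectrum P - X"
      using P op S(3) by (rule openin_spectrum_topology_basic_nbhd)
    obtain T where T: "T \<in> X" "r \<in> T" using S(2) r(1) by blast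
    then have "T \<in> spectrum_subbasic P r"
      using XP by (auto simp: spectrum_subbasic_def)
    with r(2) T(1) show False by blast
  qed
qed

section \<open>The spectrum of a prime subset\<close>

text \<open>A minimal selector \<open>S\<close> with \<open>q \<in> S \<subseteq> Q\<close> meets every common
  refinement of the given cap and of a cap that singles out \<open>q\<close> in \<open>S\<close>. The point where they meet is
  below \<open>q\<close>, and it is below an element of the given cap that lies in \<open>S \<subseteq> Q\<close>, hence in \<open>C\<close>.\<close>

lemma prime_subset_element_below:
  assumes P: "omega_poset P" and Q: "prime_subset P Q" and C: "cap P (C \<union> (P - Q))" and q: "q \<in> Q"
  shows "\<exists>l\<in>Q. l \<le> q \<and> (\<exists>c\<in>C. l \<le> c)"
proof -
  obtain S where S: "S \<in> spectrum P" "q \<in> S" "S \<subseteq> Q"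
    using Q q by (auto simp: prime_subset_iff_union_of_minimal_selectors)
  obtain D where D: "cap P D" "S \<inter> D = {q}"
    using S(1,2) by (rule minimal_selector_cap_meets_only)
  obtain L where L: "band P L" "refines L (C \<union> (P - Q))" "refines L D"
    using P C D(1) by (rule caps_common_refinement)
  obtain l where l: "l \<in> S" "l \<in> L"
    using spectrum_meets_cap[OF S(1) band_imp_cap[OF L(1)]] by blast
  obtain c d where cd: "c \<in> C \<union> (P - Q)" "l \<le> c" "d \<in> D" "l \<le> d"
    using L(2,3) l(2) unfolding refines_def by blast
  have "c \<in> S" "d \<in> S"
    using cd minimal_selector_up_closed[OF S(1) l(1)] cap_subset[OF C] cap_subset[OF D(1)] by auto
  then have "d = q" "c \<in> C" using cd D(2) S(3) by auto
  with cd l(1) S(3) show ?thesis by blast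
qed

text \<open>The direction from \<open>Q\<close> to \<open>P\<close> is again comparability with a band of \<open>P\<close> that has no element
  strictly above the given band of \<open>Q\<close>. For the converse, restrict to \<open>Q\<close> a band \<open>L\<close> of \<open>P\<close> refining
  \<open>C \<union> (P - Q)\<close>. An element of \<open>Q\<close> that is only above members of \<open>L\<close> outside \<open>Q\<close> may be comparable
  to nothing in \<open>L \<inter> Q\<close>. Only finitely many elements lie above \<open>L\<close>, so it suffices to add, for each of
  those in \<open>Q\<close>, an element of \<open>Q\<close> below it and below \<open>C\<close>.\<close>

lemma cap_prime_subset_iff:
  assumes P: "omega_poset P" and Q: "prime_subset P Q" and CQ: "C \<subseteq> Q"
  shows "cap Q C \<longleftrightarrow> cap P (C \<union> (P - Q))"
proof
  have QP: "Q \<subseteq> P" using Q by (simp add: prime_subset_def)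
  assume "cap Q C"
  then obtain B where B: "band Q B" "refines B C" by (auto simp: cap_def)
  obtain L where L: "band P L" "\<And>l b. l \<in> L \<Longrightarrow> b \<in> B \<Longrightarrow> \<not> b < l"
  proof (rule omega_poset_band_not_strictly_above[OF P])
    show "finite B" "B \<subseteq> P" using B(1) QP by (auto simp: band_def)
  qed blast
  have "\<exists>c\<in>C \<union> (P - Q). l \<le> c" if l: "l \<in> L" for l
  proof (cases "l \<in> Q")
    case True
    then obtain b where b: "b \<in> B" "l \<le> b \<or> b \<le> l" using B(1) unfolding band_def by blast
    with L(2)[OF l b(1)] have "l \<le> b" by (auto simp: order.order_iff_strict)
    moreover obtain c where "c \<in> C" "b \<le> c" using B(2) b(1) unfolding refines_def by blast
    ultimately show ?thesis by (blast intro: order_trans)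
  next
    case False
    then show ?thesis using l L(1) by (auto simp: band_def)
  qed
  then show "cap P (C \<union> (P - Q))"
    using L(1) CQ QP unfolding cap_def refines_def by blast
next
  have QP: "Q \<subseteq> P" using Q by (simp add: prime_subset_def)
  assume cap: "cap P (C \<union> (P - Q))"
  then obtain L where L: "band P L" "refines L (C \<union> (P - Q))" by (auto simp: cap_def)
  \<comment> \<open>A union of upsets is an upset.\<close>
  have up: "t \<in> Q" if "s \<in> Q" "s \<le> t" "t \<in> P" for s t
    using Q that minimal_selector_up_closed
    unfolding prime_subset_iff_union_of_minimal_selectors by blast
  obtain f where f: "\<And>q. q \<in> Q \<Longrightarrow> f q \<in> Q \<and> f q \<le> q \<and> (\<exists>c\<in>C. f q \<le> c)"
    using prime_subset_element_below[OF P Q cap] by metis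
  let ?U = "(\<Union>l\<in>L. principal_filter P l) \<inter> Q"
  let ?B = "(L \<inter> Q) \<union> f ` ?U"
  have "finite ?U"
    using L(1) omega_poset_finite_filter[OF P] by (auto simp: band_def)
  then have "finite ?B" using L(1) by (auto simp: band_def)
  moreover have "?B \<subseteq> Q" using f by auto
  moreover have "\<exists>b\<in>?B. q \<le> b \<or> b \<le> q" if q: "q \<in> Q" for q
  proof -
    obtain l where l: "l \<in> L" "q \<le> l \<or> l \<le> q" using L(1) q QP unfolding band_def by blast
    then have lP: "l \<in> P" using L(1) by (auto simp: band_def)
    from l(2) show ?thesis
    proof
      assume "q \<le> l"
      then show ?thesis using up[OF q _ lP] l(1) by blast
    next
      assume "l \<le> q"
      then have "q \<in> ?U" using l(1) q QP by (auto simp: principal_filter_def)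
      then show ?thesis using f[OF q] by blast
    qed
  qed
  ultimately have "band Q ?B" by (simp add: band_def)
  moreover have "refines ?B C"
    unfolding refines_def
  proof
    fix b assume "b \<in> ?B"
    then consider "b \<in> L" "b \<in> Q" | q where "q \<in> Q" "b = f q" by blast
    then show "\<exists>c\<in>C. b \<le> c"
    proof cases
      case 1
      then obtain c where c: "c \<in> C \<union> (P - Q)" "b \<le> c" using L(2) unfolding refines_def by blast
      then have "c \<in> Q" using up[OF 1(2)] CQ by blast
      with c show ?thesis by blast
    qed (use f in blast)
  qed
  ultimately show "cap Q C" using CQ by (auto simp: cap_def)
qed

text \<open>For \<open>C = Q - S\<close> the set \<open>C \<union> (P - Q)\<close> is \<open>P - S\<close>.\<close>

lemma selector_prime_subset_iff:
  assumes P: "omega_poset P" and Q: "prime_subset P Q"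
  shows "selector Q S \<longleftrightarrow> selector P S \<and> S \<subseteq> Q"
proof (cases "S \<subseteq> Q")
  case True
  have "Q \<subseteq> P" using Q by (simp add: prime_subset_def)
  then have "(Q - S) \<union> (P - Q) = P - S" using True by blast
  then have "cap Q (Q - S) \<longleftrightarrow> cap P (P - S)"
    using cap_prime_subset_iff[OF P Q, of "Q - S"] by simp
  then show ?thesis using True \<open>Q \<subseteq> P\<close> by (auto simp: selector_iff_compl_not_cap)
qed (simp add: selector_def)

lemma spectrum_prime_subset:
  assumes "omega_poset P" "prime_subset P Q"
  shows "spectrum Q = {S \<in> spectrum P. S \<subseteq> Q}"
  unfolding spectrum_def minimal_selector_def selector_prime_subset_iff[OF assms] by blast

lemma Union_spectrum_prime_subset:
  assumes "omega_poset P" "prime_subset P Q"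
  shows "\<Union>(spectrum Q) = Q"
  using assms(2) unfolding spectrum_prime_subset[OF assms]
    prime_subset_iff_union_of_minimal_selectors by blast

lemma prime_subset_Union_minimal_selectors:
  assumes "X \<subseteq> spectrum P"
  shows "prime_subset P (\<Union>X)"
  using assms spectrum_subset unfolding prime_subset_iff_union_of_minimal_selectors by blast

section \<open>The correspondence between prime subsets and closed subsets\<close>

theorem corollary2p25:
  fixes P :: "'a::order set"
  assumes "omega_poset P"
  shows "(\<forall>Q. prime_subset P Q \<longrightarrow> closedin (spectrum_topology P) (spectrum Q))
    \<and> (\<forall>X. closedin (spectrum_topology P) X \<longrightarrow> prime_subset P (\<Union>X))
    \<and> (\<forall>Q. prime_subset P Q \<longrightarrow> \<Union>(spectrum Q) = Q)
    \<and> (\<forall>X. closedin (spectrum_topology P) X \<longrightarrow> spectrum (\<Union>X) = X)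
    \<and> (\<forall>Q Q'. prime_subset P Q \<and> prime_subset P Q' \<longrightarrow>
          (Q \<subseteq> Q' \<longleftrightarrow> spectrum Q \<subseteq> spectrum Q'))
    \<and> (\<forall>X Y. closedin (spectrum_topology P) X \<and> closedin (spectrum_topology P) Y \<longrightarrow>
          (X \<subseteq> Y \<longleftrightarrow> \<Union>X \<subseteq> \<Union>Y))"
proof -
  have closed: "closedin (spectrum_topology P) (spectrum Q)" if "prime_subset P Q" for Q
    unfolding spectrum_prime_subset[OF assms that] by (rule closedin_minimal_selectors_within)
  have prime: "prime_subset P (\<Union>X)" if "closedin (spectrum_topology P) X" for X
    using closedin_subset[OF that] unfolding topspace_spectrum_topology
    by (rule prime_subset_Union_minimal_selectors)
  have union: "\<Union>(spectrum Q) = Q" if "prime_subset P Q" for Q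
    using assms that by (rule Union_spectrum_prime_subset)
  have spec: "spectrum (\<Union>X) = X" if "closedin (spectrum_topology P) X" for X
    using spectrum_prime_subset[OF assms prime[OF that]]
      closedin_spectrum_eq_minimal_selectors_within_Union[OF assms that] by simp
  have iso: "Q \<subseteq> Q' \<longleftrightarrow> spectrum Q \<subseteq> spectrum Q'"
    if "prime_subset P Q" "prime_subset P Q'" for Q Q'
  proof
    assume "Q \<subseteq> Q'"
    then show "spectrum Q \<subseteq> spectrum Q'"
      unfolding that[THEN spectrum_prime_subset[OF assms]] by blast
  next
    assume "spectrum Q \<subseteq> spectrum Q'"
    from Union_mono[OF this] show "Q \<subseteq> Q'"
      unfolding that[THEN union] .
  qed
  have iso': "X \<subseteq> Y \<longleftrightarrow> \<Union>X \<subseteq> \<Union>Y"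
    if "closedin (spectrum_topology P) X" "closedin (spectrum_topology P) Y" for X Y
    using iso[OF prime[OF that(1)] prime[OF that(2)]] spec[OF that(1)] spec[OF that(2)] by simp
  show ?thesis
    by (intro conjI allI impI; (elim conjE)?) (fact closed prime union spec iso iso')+
qed

end
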